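(* Let $X\in\mathfrak{sl}(3,\mathbb{R})$. If $X$ has an eigenvalue $i\beta$ for some $0\neq\beta\in\mathbb{R}$, then the one-parameter subgroup $t\mapsto e^{tX}$ of $SL(3,\mathbb{R})$ generated by $X$ is ambient automorphic to a one-parameter subgroup of the form $$\phi(t)=\begin{pmatrix}\cos\beta t&\sin\beta t&0\\-\sin\beta t&\cos\beta t&0\\0&0&1\end{pmatrix}.$$
   Context: $\mathfrak{sl}(3,\mathbb{R})$ is the Lie algebra of traceless real $3\times3$ matrices. A one-parameter subgroup of a Lie group $G$ is a continuous group homomorphism $\mathbb{R}\to G$. Given one-parameter subgroups $\phi_1,\phi_2:\mathbb{R}\to G$, an ambient automorphism from $\phi_1$ to $\phi_2$ is a continuous map $F:G\times[0,1]\to G$ such that, writing $F_s(A):=F(A,s)$: $F_0$ is the identity map on $G$; $F_s$ is both a homeomorphism and a group automorphism of $G$ for all $s\in[0,1]$; and $F_1\circ\phi_1=\phi_2$. In this case $\phi_1$ is said to be ambient automorphic to $\phi_2$. *)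

theory Defs
  imports "HOL-Analysis.Analysis" "HOL-Algebra.Group"
begin

definition SL :: "(real^'n^'n) monoid" where
  "SL = \<lparr>carrier = {A. det A = 1}, monoid.mult = (**), one = mat 1\<rparr>"

lemma group_SL: "group (SL :: (real^'n^'n) monoid)"
proof (rule groupI)
  fix A :: "real^'n^'n"
  assume "A \<in> carrier SL"
  then have detA: "det A = 1" by (simp add: SL_def)
  then have "invertible A" by (simp add: invertible_det_nz)
  then obtain B where B: "B ** A = mat 1" by (auto simp: invertible_def)
  then have "det B * det A = 1" by (metis det_mul det_I)
  with detA B show "\<exists>B\<in>carrier SL. B \<otimes>\<^bsub>SL\<^esub> A = \<one>\<^bsub>SL\<^esub>"
    by (auto simp: SL_def)
qed (auto simp: SL_def det_mul matrix_mul_assoc)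

definition sl :: "(real^'n^'n) set" where
  "sl = {X. trace X = 0}"

(* The class-based power and product on this type are componentwise, hence the matrix
   power is written as an iterated matrix product. *)
definition matrix_exp :: "real^'n^'n \<Rightarrow> real^'n^'n" where
  "matrix_exp X = (\<Sum>k. (1 / fact k) *\<^sub>R (((**) X ^^ k) (mat 1)))"

definition complex_eigenvalue :: "real^'n^'n \<Rightarrow> complex \<Rightarrow> bool" where
  "complex_eigenvalue X c \<longleftrightarrow>
     (\<exists>v :: complex^'n. v \<noteq> 0 \<and> map_matrix complex_of_real X *v v = c *s v)"

(* G is a group carried by a subset of a topological space; the topology on
   its carrier is the subspace topology. *)
definition one_parameter_subgroup ::
  "('a::topological_space, 'b) monoid_scheme \<Rightarrow> (real \<Rightarrow> 'a) \<Rightarrow> bool" where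
  "one_parameter_subgroup G \<phi> \<longleftrightarrow>
     continuous_on UNIV \<phi> \<and>
     \<phi> \<in> hom \<lparr>carrier = UNIV, monoid.mult = (+), one = 0\<rparr> G"

definition ambient_automorphism ::
  "('a::topological_space, 'b) monoid_scheme \<Rightarrow> (real \<Rightarrow> 'a) \<Rightarrow> (real \<Rightarrow> 'a) \<Rightarrow> ('a \<times> real \<Rightarrow> 'a) \<Rightarrow> bool"
  where
  "ambient_automorphism G \<phi>\<^sub>1 \<phi>\<^sub>2 F \<longleftrightarrow>
     one_parameter_subgroup G \<phi>\<^sub>1 \<and> one_parameter_subgroup G \<phi>\<^sub>2 \<and>
     continuous_on (carrier G \<times> {0..1}) F \<and>
     F \<in> carrier G \<times> {0..1} \<rightarrow> carrier G \<and>
     (\<forall>A\<in>carrier G. F (A, 0) = A) \<and>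
     (\<forall>s\<in>{0..1}. (\<lambda>A. F (A, s)) \<in> iso G G \<and>
        (\<exists>g. homeomorphism (carrier G) (carrier G) (\<lambda>A. F (A, s)) g)) \<and>
     (\<forall>t. F (\<phi>\<^sub>1 t, 1) = \<phi>\<^sub>2 t)"

definition ambient_automorphic ::
  "('a::topological_space, 'b) monoid_scheme \<Rightarrow> (real \<Rightarrow> 'a) \<Rightarrow> (real \<Rightarrow> 'a) \<Rightarrow> bool" where
  "ambient_automorphic G \<phi>\<^sub>1 \<phi>\<^sub>2 \<longleftrightarrow> (\<exists>F. ambient_automorphism G \<phi>\<^sub>1 \<phi>\<^sub>2 F)"

end

theory Submission
  imports Defs
begin

text \<open>
  Write \<open>v = a + \<i> b\<close> for an eigenvector to \<open>\<i> \<beta>\<close>. Comparing real and imaginary parts, \<open>X\<close> maps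
  \<open>a\<close> to \<open>- \<beta> b\<close> and \<open>b\<close> to \<open>\<beta> a\<close>, so on the plane of \<open>a\<close> and \<open>b\<close> it is already an infinitesimal
  rotation. As the trace vanishes, the remaining eigenvalue is \<open>0\<close>; together with a kernel vector
  \<open>c\<close> this gives a matrix \<open>P\<close> with columns \<open>a, b, c\<close> and \<open>X P = P J\<close>, where \<open>J\<close> generates the
  rotations in question (\<open>rotation_normal_form\<close>). Hence the subgroup generated by \<open>X\<close> is the
  conjugate by \<open>P\<close> of the rotation subgroup (\<open>matrix_exp_eq_conjugate_rotation\<close>); that it lies in
  the special linear group and is continuous can be read off from this conjugacy.

  The sign of \<open>c\<close> is at our disposal, so \<open>P\<close> may be taken of positive determinant. A path \<open>g\<close> of
  invertible matrices from the identity to \<open>P\<close> then yields the ambient automorphism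
  \<open>F (A, s) = (g s)\<^sup>-\<^sup>1 A (g s)\<close> (\<open>ambient_automorphic_conjugate\<close>). Here \<open>g s\<close> may have
  any positive determinant, since scalars act trivially by conjugation.

  There remains the existence of \<open>g\<close>, that is, the connectedness of the group of real matrices of
  order three with positive determinant (\<open>connected_to_1_iff\<close>). Along the segment from the identity to
  \<open>P\<close> the determinant is a combination of the coefficients of the characteristic polynomial, and
  stays positive when the trace and the sum of the principal minors of \<open>P\<close> are nonnegative. Every
  \<open>P\<close> is brought to this form by multiplication with a few explicit matrices which are themselves
  connected to the identity: cyclic permutations, half turns, and similarities of a coordinate plane.
\<close>

section \<open>Matrix inversion\<close>

lemma matrix_inv_inverse:
  fixes A :: "real^'n^'n"
  assumes "det A \<noteq> 0"
  shows "A ** matrix_inv A = mat 1" and "matrix_inv A ** A = mat 1"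
proof -
  have "\<exists>B. A ** B = mat 1 \<and> B ** A = mat 1"
    using assms by (simp add: invertible_det_nz flip: invertible_def)
  from someI_ex[OF this]
  show "A ** matrix_inv A = mat 1" and "matrix_inv A ** A = mat 1"
    by (simp_all add: matrix_inv_def)
qed

lemma matrix_inv_mat_1: "matrix_inv (mat 1 :: real^'n^'n) = mat 1"
  using matrix_inv_inverse(1)[of "mat 1 :: real^'n^'n"] by simp

text \<open>Cramer's rule is used to see that inversion is continuous: it exhibits the entries of the inverse
  as quotients of determinants.\<close>

lemma matrix_inv_Cramer:
  fixes A :: "real^'n^'n"
  assumes "det A \<noteq> 0"
  shows "matrix_inv A =
    (\<chi> k j. det (\<chi> i l. if l = k then (mat 1 :: real^'n^'n) $ i $ j else A $ i $ l) / det A)"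
proof -
  have "matrix_inv A $ k $ j =
      det (\<chi> i l. if l = k then (mat 1 :: real^'n^'n) $ i $ j else A $ i $ l) / det A" for k j
  proof -
    have "A *v (\<chi> k. matrix_inv A $ k $ j) = (\<chi> i. (A ** matrix_inv A) $ i $ j)"
      by (simp add: vec_eq_iff matrix_vector_mult_def matrix_matrix_mult_def)
    also have "\<dots> = (\<chi> i. (mat 1 :: real^'n^'n) $ i $ j)"
      by (simp add: matrix_inv_inverse(1)[OF assms])
    finally have "(\<chi> k. matrix_inv A $ k $ j) =
        (\<chi> k. det (\<chi> i l. if l = k then (mat 1 :: real^'n^'n) $ i $ j else A $ i $ l) / det A)"
      by (simp add: cramer[OF assms] cong: if_cong)
    from arg_cong[OF this, of "\<lambda>v. v $ k"] show ?thesis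
      by simp
  qed
  then show ?thesis
    by (simp add: vec_eq_iff)
qed

lemma continuous_on_matrix_mult:
  fixes f :: "'a::topological_space \<Rightarrow> real^'n^'m" and g :: "'a \<Rightarrow> real^'k^'n"
  assumes "continuous_on S f" and "continuous_on S g"
  shows "continuous_on S (\<lambda>x. f x ** g x)"
  unfolding matrix_matrix_mult_def using assms by (intro continuous_intros)

lemma continuous_on_det:
  fixes f :: "'a::topological_space \<Rightarrow> real^'n^'n"
  assumes "continuous_on S f"
  shows "continuous_on S (\<lambda>x. det (f x))"
  unfolding det_def using assms by (intro continuous_intros)

lemma continuous_on_matrix_inv:
  fixes f :: "'a::topological_space \<Rightarrow> real^'n^'n"
  assumes f: "continuous_on S f" and nz: "\<And>x. x \<in> S \<Longrightarrow> det (f x) \<noteq> 0"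
  shows "continuous_on S (\<lambda>x. matrix_inv (f x))"
proof -
  have "continuous_on S (\<lambda>x. if l = k then (mat 1 :: real^'n^'n) $ i $ j else f x $ i $ l)" 
    for i j k l :: 'n
    using f by (cases "l = k") (auto intro: continuous_intros)
  then have "continuous_on S (\<lambda>x. \<chi> k j.
      det (\<chi> i l. if l = k then (mat 1 :: real^'n^'n) $ i $ j else f x $ i $ l) / det (f x))"
    using nz by (intro continuous_intros continuous_on_det f) auto
  then show ?thesis
    by (rule continuous_on_eq) (simp add: matrix_inv_Cramer nz)
qed

section \<open>Conjugation\<close>

lemma matrix_mult_cancel_middle:
  fixes A :: "real^'n^'n"
  assumes "B ** C = mat 1"
  shows "(A ** B) ** (C ** D) = A ** D"
proof -
  have "(A ** B) ** (C ** D) = A ** (B ** C) ** D"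
    by (simp only: matrix_mul_assoc)
  then show ?thesis
    using assms by simp
qed

lemma conjugation_SL:
  fixes P Q :: "real^'n^'n"
  assumes PQ: "P ** Q = mat 1" and QP: "Q ** P = mat 1"
  shows "(\<lambda>A. Q ** A ** P) \<in> iso SL SL"
    and "homeomorphism (carrier SL) (carrier SL) (\<lambda>A. Q ** A ** P) (\<lambda>A. P ** A ** Q)"
proof -
  have dPQ: "det P * det Q = 1"
    using PQ by (metis det_mul det_I)
  have closed: "Q ** A ** P \<in> carrier SL" "P ** A ** Q \<in> carrier SL" if "A \<in> carrier SL" for A
    using that dPQ by (simp_all add: SL_def det_mul mult.commute)
  have inverse: "P ** (Q ** A ** P) ** Q = A" "Q ** (P ** A ** Q) ** P = A" for A
    using PQ QP matrix_mul_lid matrix_mul_rid matrix_mul_assoc by metis+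
  have "bij_betw (\<lambda>A. Q ** A ** P) (carrier SL) (carrier SL)"
    by (rule bij_betw_byWitness[where f' = "\<lambda>A. P ** A ** Q"]) (auto simp: inverse closed)
  moreover have "Q ** (A ** B) ** P = (Q ** A ** P) ** (Q ** B ** P)" for A B
    using matrix_mult_cancel_middle[OF PQ, of "Q ** A" "B ** P"]
    by (simp add: matrix_mul_assoc)
  then have "(\<lambda>A. Q ** A ** P) \<in> hom SL SL"
    using closed by (auto intro!: homI) (auto simp: SL_def)
  ultimately show "(\<lambda>A. Q ** A ** P) \<in> iso SL SL"
    by (simp add: iso_def)
  show "homeomorphism (carrier SL) (carrier SL) (\<lambda>A. Q ** A ** P) (\<lambda>A. P ** A ** Q)"
    by (rule homeomorphismI)
      (auto simp: inverse closed intro!: continuous_on_matrix_mult continuous_intros)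
qed

lemma one_parameter_subgroup_conjugate:
  fixes P Q :: "real^'n^'n"
  assumes "P ** Q = mat 1" and "Q ** P = mat 1" and "one_parameter_subgroup SL \<phi>"
  shows "one_parameter_subgroup SL (\<lambda>t. Q ** \<phi> t ** P)"
proof -
  have "(\<lambda>A. Q ** A ** P) \<circ> \<phi> \<in> hom \<lparr>carrier = UNIV, monoid.mult = (+), one = 0\<rparr> SL"
    using assms(3) conjugation_SL(1)[OF assms(1,2)]
    by (intro hom_compose[where H = SL]) (auto simp: one_parameter_subgroup_def iso_def)
  then show ?thesis
    using assms(3)
    by (auto simp: one_parameter_subgroup_def o_def intro!: continuous_on_matrix_mult continuous_intros)
qed

text \<open>Conjugation by the points of a path from \<open>mat 1\<close> to \<open>P\<close> deforms the identity automorphism into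
  conjugation by \<open>P\<close>. The path may leave \<open>SL\<close>: conjugation by any invertible matrix preserves the
  determinant.\<close>

lemma ambient_automorphic_conjugate:
  fixes P :: "real^'n^'n"
  assumes P: "path_component {A. det A > 0} (mat 1) P" and \<phi>: "one_parameter_subgroup SL \<phi>"
  shows "ambient_automorphic SL (\<lambda>t. P ** \<phi> t ** matrix_inv P) \<phi>"
proof -
  obtain g where g: "path g" "path_image g \<subseteq> {A. det A > 0}" "g 0 = mat 1" "g 1 = P"
    using P by (auto simp: path_component_def pathstart_def pathfinish_def)
  have det_g: "det (g s) \<noteq> 0" if "s \<in> {0..1}" for s
    using g(2) that by (fastforce simp: path_image_def)
  define F where "F = (\<lambda>(A, s). matrix_inv (g s) ** A ** g s)"
  note inv_g = matrix_inv_inverse[OF det_g]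
  have inv_P: "P ** matrix_inv P = mat 1" "matrix_inv P ** P = mat 1"
    using inv_g[of 1] g(4) by simp_all
  have cont_g: "continuous_on (carrier SL \<times> {0..1}) (\<lambda>p. g (snd p))"
    using g(1) unfolding path_def
    by (rule continuous_on_compose2) (auto intro: continuous_intros)
  have "continuous_on (carrier SL \<times> {0..1}) F"
    unfolding F_def case_prod_unfold
    by (intro continuous_on_matrix_mult continuous_on_matrix_inv cont_g continuous_intros)
      (auto dest: det_g)
  moreover have iso: "(\<lambda>A. F (A, s)) \<in> iso SL SL" if "s \<in> {0..1}" for s
    unfolding F_def prod.case using inv_g[OF that] by (rule conjugation_SL)
  moreover have "\<exists>h. homeomorphism (carrier SL) (carrier SL) (\<lambda>A. F (A, s)) h" if "s \<in> {0..1}" for s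
    unfolding F_def prod.case using conjugation_SL(2)[OF inv_g[OF that]] by blast
  moreover have "F \<in> carrier SL \<times> {0..1} \<rightarrow> carrier SL"
    using iso unfolding iso_def hom_def by blast
  moreover have "F (A, 0) = A" for A
    by (simp add: F_def g(3) matrix_inv_mat_1)
  moreover have "F (P ** \<phi> t ** matrix_inv P, 1) = \<phi> t" for t
    unfolding F_def prod.case g(4)
    using inv_P matrix_mul_lid matrix_mul_rid matrix_mul_assoc by metis
  moreover have "one_parameter_subgroup SL (\<lambda>t. P ** \<phi> t ** matrix_inv P)"
    using inv_P(2,1) \<phi> by (rule one_parameter_subgroup_conjugate)
  ultimately show ?thesis
    using \<phi> unfolding ambient_automorphic_def ambient_automorphism_def by blast
qed

section \<open>Connectedness of the 3x3 matrices of positive determinant\<close>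

lemma matrix_3_eq_iff:
  fixes A B :: "real^3^3"
  shows "A = B \<longleftrightarrow> A$1$1 = B$1$1 \<and> A$1$2 = B$1$2 \<and> A$1$3 = B$1$3
    \<and> A$2$1 = B$2$1 \<and> A$2$2 = B$2$2 \<and> A$2$3 = B$2$3
    \<and> A$3$1 = B$3$1 \<and> A$3$2 = B$3$2 \<and> A$3$3 = B$3$3"
  by (auto simp: vec_eq_iff forall_3)

lemma matrix_mult_3_nth:
  fixes A B :: "real^3^3"
  shows "(A ** B) $ i $ j = A$i$1 * B$1$j + A$i$2 * B$2$j + A$i$3 * B$3$j"
  by (simp add: matrix_matrix_mult_def sum_3)

lemma mat_1_3_nth:
  "(mat 1 :: real^3^3) $ i $ j = (if i = j then 1 else 0)"
  by (simp add: mat_def)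

text \<open>The coefficient of \<open>x\<close> in \<open>det (x I + A)\<close>.\<close>

definition principal_minors :: "real^3^3 \<Rightarrow> real" where
  "principal_minors A = (A$1$1 * A$2$2 - A$1$2 * A$2$1) + (A$1$1 * A$3$3 - A$1$3 * A$3$1)
     + (A$2$2 * A$3$3 - A$2$3 * A$3$2)"

abbreviation "connected_to_1 \<equiv> path_component {A :: real^3^3. det A > 0} (mat 1)"

text \<open>By homogeneity of the characteristic polynomial,
  \<open>det ((1 - u) I + u P) = (1 - u)\<^sup>3 + (1 - u)\<^sup>2 u trace P + (1 - u) u\<^sup>2 principal_minors P + u\<^sup>3 det P\<close>,
  and under the hypotheses no term is negative, while the outer two do not vanish together.\<close>

lemma connected_to_1_segment:
  assumes "det P > 0" and "trace P \<ge> 0" and "principal_minors P \<ge> 0"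
  shows "connected_to_1 P"
proof -
  have "closed_segment (mat 1) P \<subseteq> {A. det A > 0}"
  proof clarify
    fix A assume "A \<in> closed_segment (mat 1) P"
    then obtain u where u: "0 \<le> u" "u \<le> 1" and A: "A = (1 - u) *\<^sub>R mat 1 + u *\<^sub>R P"
      by (auto simp: closed_segment_def)
    have "det A = (1 - u)^3 + (1 - u)^2 * u * trace P + (1 - u) * u^2 * principal_minors P
        + u^3 * det P"
      unfolding A by (simp add: det_3 trace_def sum_3 principal_minors_def mat_1_3_nth
        power2_eq_square power3_eq_cube algebra_simps)
    moreover have "(1 - u)^3 + u^3 * det P > 0"
      using u assms(1) by (cases "u = 0") (auto intro: add_nonneg_pos)
    moreover have "(1 - u)^2 * u * trace P \<ge> 0" "(1 - u) * u^2 * principal_minors P \<ge> 0"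
      using u assms by simp_all
    ultimately show "det A > 0" by linarith
  qed
  then show ?thesis by (rule path_component_linepath)
qed

text \<open>Follow a path to \<open>A\<close> and then the left translate by \<open>A\<close> of a path to \<open>B\<close>.\<close>

lemma connected_to_1_mult:
  assumes A: "connected_to_1 A" and B: "connected_to_1 B"
  shows "connected_to_1 (A ** B)"
proof -
  have dA: "det A > 0" using A path_component_mem(2) by blast
  obtain g where g: "path g" "path_image g \<subseteq> {A. det A > 0}" "g 0 = mat 1" "g 1 = B"
    using B by (auto simp: path_component_def pathstart_def pathfinish_def)
  have "path (\<lambda>t. A ** g t)"
    using g(1) unfolding path_def by (intro continuous_on_matrix_mult continuous_intros)
  moreover have "path_image (\<lambda>t. A ** g t) \<subseteq> {A. det A > 0}"
    using g(2) dA by (auto simp: path_image_def det_mul)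
  ultimately have "path_component {A. det A > 0} A (A ** B)"
    unfolding path_component_def pathstart_def pathfinish_def
    using g(3,4) by (intro exI[of _ "\<lambda>t. A ** g t"]) auto
  with A show ?thesis by (rule path_component_trans)
qed

text \<open>Multiplication by the complex number \<open>x - \<i> y\<close> on the plane of the first two coordinates, with the
  third coordinate fixed. For \<open>x = cos \<theta>\<close> and \<open>y = sin \<theta>\<close> these are the rotations of the target subgroup;
  \<open>plane_similarity 0 0\<close> is the projection onto the axis.\<close>

definition plane_similarity :: "real \<Rightarrow> real \<Rightarrow> real^3^3" where
  "plane_similarity x y = vector [vector [x, y, 0], vector [- y, x, 0], vector [0, 0, 1]]"

lemma plane_similarity_mult:
  "plane_similarity x y ** plane_similarity u v = plane_similarity (x * u - y * v) (x * v + y * u)"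
  by (simp add: matrix_3_eq_iff matrix_mult_3_nth plane_similarity_def)

lemma connected_to_1_plane_similarity:
  assumes "x \<noteq> 0 \<or> y \<noteq> 0"
  shows "connected_to_1 (plane_similarity x y)"
proof -
  have half: "connected_to_1 (plane_similarity x y)" if "x \<ge> 0" "x \<noteq> 0 \<or> y \<noteq> 0" for x y
  proof (rule connected_to_1_segment)
    have "x * x + y * y > 0"
      using that(2) by (metis power2_eq_square sum_power2_gt_zero_iff)
    then show "det (plane_similarity x y) > 0" "principal_minors (plane_similarity x y) \<ge> 0"
      using that(1) by (simp_all add: plane_similarity_def det_3 principal_minors_def)
    show "trace (plane_similarity x y) \<ge> 0"
      using that(1) by (simp add: plane_similarity_def trace_def sum_3)
  qed
  show ?thesis
  proof (cases "x \<ge> 0")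
    case True
    then show ?thesis using assms by (rule half)
  next
    case False
    \<comment> \<open>Two quarter turns of the plane reverse the signs of \<open>x\<close> and \<open>y\<close>.\<close>
    have "plane_similarity x y =
        plane_similarity 0 1 ** plane_similarity 0 1 ** plane_similarity (- x) (- y)"
      by (simp add: plane_similarity_mult)
    then show ?thesis
      using False half[of 0 1] half[of "- x" "- y"] by (simp add: connected_to_1_mult)
  qed
qed

text \<open>Two closed half-planes through the origin always share a nonzero vector: one of the two directions
  of the boundary line of the first half-plane lies in the second.\<close>

lemma obtain_two_nonneg_forms:
  fixes l\<^sub>1 l\<^sub>2 m\<^sub>1 m\<^sub>2 :: real
  obtains x y where "x \<noteq> 0 \<or> y \<noteq> 0" and "l\<^sub>1 * x + l\<^sub>2 * y \<ge> 0" and "m\<^sub>1 * x + m\<^sub>2 * y \<ge> 0"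
proof (cases "l\<^sub>1 = 0 \<and> l\<^sub>2 = 0")
  case True
  show ?thesis
  proof (cases "m\<^sub>1 \<ge> 0")
    case True
    then show ?thesis using that[of 1 0] \<open>l\<^sub>1 = 0 \<and> l\<^sub>2 = 0\<close> by simp
  next
    case False
    then show ?thesis using that[of "-1" 0] \<open>l\<^sub>1 = 0 \<and> l\<^sub>2 = 0\<close> by simp
  qed
next
  case False
  show ?thesis
  proof (cases "m\<^sub>2 * l\<^sub>1 - m\<^sub>1 * l\<^sub>2 \<ge> 0")
    case True
    then show ?thesis using that[of "- l\<^sub>2" l\<^sub>1] \<open>\<not> (l\<^sub>1 = 0 \<and> l\<^sub>2 = 0)\<close> by (auto simp: algebra_simps)
  next
    case False
    then show ?thesis
      using that[of l\<^sub>2 "- l\<^sub>1"] \<open>\<not> (l\<^sub>1 = 0 \<and> l\<^sub>2 = 0)\<close> by (auto simp: algebra_simps)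
  qed
qed

text \<open>Multiplying \<open>P\<close> on the right by \<open>plane_similarity x y\<close> keeps the entry \<open>P$3$3\<close> and multiplies the
  complementary minor by \<open>x\<^sup>2 + y\<^sup>2\<close>. The other contributions to the trace and to the sum of the
  principal minors are linear forms in \<open>x\<close> and \<open>y\<close>. The corner contributions are positive by
  hypothesis, and \<open>x\<close> and \<open>y\<close> can be chosen such that both forms are nonnegative.\<close>

lemma connected_to_1_of_positive_corner:
  assumes "det P > 0" and "P$3$3 > 0" and "P$1$1 * P$2$2 - P$1$2 * P$2$1 > 0"
  shows "connected_to_1 P"
proof -
  obtain x y where xy: "x \<noteq> 0 \<or> y \<noteq> 0"
    and L: "(P$1$1 + P$2$2) * x + (P$2$1 - P$1$2) * y \<ge> 0"
    and M: "(P$1$1 * P$3$3 - P$1$3 * P$3$1 + P$2$2 * P$3$3 - P$2$3 * P$3$2) * x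
      + (P$2$1 * P$3$3 - P$2$3 * P$3$1 - P$1$2 * P$3$3 + P$1$3 * P$3$2) * y \<ge> 0"
    by (rule obtain_two_nonneg_forms)
  define r where "r = x * x + y * y"
  have r: "r > 0"
    using xy unfolding r_def by (metis power2_eq_square sum_power2_gt_zero_iff)
  have "connected_to_1 (P ** plane_similarity x y)"
  proof (rule connected_to_1_segment)
    have "det (plane_similarity x y) = r"
      by (simp add: plane_similarity_def det_3 r_def)
    then show "det (P ** plane_similarity x y) > 0"
      using assms(1) r by (simp add: det_mul)
    have "trace (P ** plane_similarity x y) = (P$1$1 + P$2$2) * x + (P$2$1 - P$1$2) * y + P$3$3"
      by (simp add: trace_def sum_3 matrix_mult_3_nth plane_similarity_def algebra_simps)
    then show "trace (P ** plane_similarity x y) \<ge> 0"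
      using L assms(2) by simp
    have "principal_minors (P ** plane_similarity x y) = r * (P$1$1 * P$2$2 - P$1$2 * P$2$1)
      + ((P$1$1 * P$3$3 - P$1$3 * P$3$1 + P$2$2 * P$3$3 - P$2$3 * P$3$2) * x
      + (P$2$1 * P$3$3 - P$2$3 * P$3$1 - P$1$2 * P$3$3 + P$1$3 * P$3$2) * y)"
      by (simp add: principal_minors_def matrix_mult_3_nth plane_similarity_def r_def algebra_simps)
    then show "principal_minors (P ** plane_similarity x y) \<ge> 0"
      using M r assms(3) by simp
  qed
  \<comment> \<open>The similarity is undone by its inverse, which is another plane similarity.\<close>
  moreover have "connected_to_1 (plane_similarity (x / r) (- y / r))"
    using xy r by (intro connected_to_1_plane_similarity) auto
  moreover have "P ** plane_similarity x y ** plane_similarity (x / r) (- y / r) = P"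
  proof -
    have "x * (x / r) - y * (- y / r) = 1"
      using r xy by (simp add: r_def flip: add_divide_distrib)
    then have "plane_similarity x y ** plane_similarity (x / r) (- y / r) = mat 1"
      by (simp add: plane_similarity_mult) (simp add: matrix_3_eq_iff plane_similarity_def mat_1_3_nth)
    then show ?thesis
      by (simp flip: matrix_mul_assoc)
  qed
  ultimately show ?thesis
    using connected_to_1_mult by metis
qed

definition quarter_turn :: "real^3^3" where
  "quarter_turn = vector [vector [1, 0, 0], vector [0, 0, - 1], vector [0, 1, 0]]"

lemma connected_to_1_quarter_turn: "connected_to_1 quarter_turn"
  by (rule connected_to_1_segment)
    (simp_all add: quarter_turn_def det_3 trace_def sum_3 principal_minors_def)

text \<open>If the corner entry and its complementary minor are both negative, a half turn about the first axis
  makes both positive: it negates the second and the third row. The half turn is not within reach of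
  \<open>connected_to_1_segment\<close>, since \<open>- 1\<close> is among its eigenvalues, but it is the square of a quarter turn.\<close>

lemma connected_to_1_of_same_sign_corner:
  assumes "det P > 0" and "P$3$3 * (P$1$1 * P$2$2 - P$1$2 * P$2$1) > 0"
  shows "connected_to_1 P"
proof (cases "P$3$3 > 0")
  case True
  then show ?thesis
    using assms by (intro connected_to_1_of_positive_corner) (auto simp: zero_less_mult_iff)
next
  case False
  define H where "H = quarter_turn ** quarter_turn"
  have H: "connected_to_1 H"
    unfolding H_def by (intro connected_to_1_mult connected_to_1_quarter_turn)
  have HH: "H ** (H ** P) = P"
    by (simp add: H_def matrix_3_eq_iff matrix_mult_3_nth quarter_turn_def)
  have "connected_to_1 (H ** P)"
  proof (rule connected_to_1_of_positive_corner)
    show "det (H ** P) > 0"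
      using assms(1) H path_component_mem(2) by (fastforce simp: det_mul)
    show "(H ** P)$3$3 > 0"
      "(H ** P)$1$1 * (H ** P)$2$2 - (H ** P)$1$2 * (H ** P)$2$1 > 0"
      using False assms(2)
      by (auto simp: H_def matrix_mult_3_nth quarter_turn_def zero_less_mult_iff)
  qed
  then show ?thesis
    using connected_to_1_mult[OF H] HH by metis
qed

definition cyclic_shift :: "real^3^3" where
  "cyclic_shift = vector [vector [0, 1, 0], vector [0, 0, 1], vector [1, 0, 0]]"

lemma connected_to_1_cyclic_shift: "connected_to_1 cyclic_shift"
  by (rule connected_to_1_segment)
    (simp_all add: cyclic_shift_def det_3 trace_def sum_3 principal_minors_def)

theorem connected_to_1_iff: "connected_to_1 P \<longleftrightarrow> det P > 0"
proof
  show "det P > 0" if "connected_to_1 P"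
    using that path_component_mem(2) by blast
next
  assume P: "det P > 0"
  let ?S = cyclic_shift
  note shift = connected_to_1_cyclic_shift
  have S: "det ?S = 1"
    by (simp add: cyclic_shift_def det_3)
  have rotate: "?S ** (?S ** (?S ** Q)) = Q" for Q :: "real^3^3"
    by (simp add: matrix_3_eq_iff matrix_mult_3_nth cyclic_shift_def)
  \<comment> \<open>Expanding \<open>det P\<close> along the third column, some entry has the same sign as its cofactor. A cyclic
    shift of the rows, which preserves the cofactors, moves this entry into the corner.\<close>
  have "P$3$3 * (P$1$1 * P$2$2 - P$1$2 * P$2$1) + P$1$3 * (P$2$1 * P$3$2 - P$2$2 * P$3$1)
      + P$2$3 * (P$3$1 * P$1$2 - P$3$2 * P$1$1) > 0"
    using P by (simp add: det_3 algebra_simps)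
  then consider "P$3$3 * (P$1$1 * P$2$2 - P$1$2 * P$2$1) > 0"
    | "P$1$3 * (P$2$1 * P$3$2 - P$2$2 * P$3$1) > 0"
    | "P$2$3 * (P$3$1 * P$1$2 - P$3$2 * P$1$1) > 0"
    by linarith
  then show "connected_to_1 P"
  proof cases
    case 1
    with P show ?thesis by (rule connected_to_1_of_same_sign_corner)
  next
    case 2
    then have conn: "connected_to_1 (?S ** P)"
      using P S by (intro connected_to_1_of_same_sign_corner)
        (simp_all add: det_mul, simp add: matrix_mult_3_nth cyclic_shift_def)
    show ?thesis
      using connected_to_1_mult[OF shift connected_to_1_mult[OF shift conn]] by (simp only: rotate)
  next
    case 3
    then have conn: "connected_to_1 (?S ** (?S ** P))"
      using P S by (intro connected_to_1_of_same_sign_corner)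
        (simp_all add: det_mul, simp add: matrix_mult_3_nth cyclic_shift_def)
    show ?thesis
      using connected_to_1_mult[OF shift conn] by (simp only: rotate)
  qed
qed

section \<open>The exponential of a conjugate of an infinitesimal rotation\<close>

definition infinitesimal_rotation :: "real \<Rightarrow> real^3^3" where
  "infinitesimal_rotation \<theta> = vector [vector [0, \<theta>, 0], vector [- \<theta>, 0, 0], vector [0, 0, 0]]"

text \<open>The square of an infinitesimal rotation is a multiple of the projection onto the plane, so that all
  its powers lie in the span of three fixed matrices. The coefficients of the exponential series
  with respect to these are the Taylor terms of cosine, of sine, and of the constant \<open>1\<close>.\<close>

lemma infinitesimal_rotation_power:
  "(1 / fact k) *\<^sub>R ((**) (infinitesimal_rotation \<theta>) ^^ k) (mat 1) =
     (cos_coeff k * \<theta> ^ k) *\<^sub>R (plane_similarity 1 0 - plane_similarity 0 0)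
     + (sin_coeff k * \<theta> ^ k) *\<^sub>R (plane_similarity 0 1 - plane_similarity 0 0)
     + (if k = 0 then 1 else 0) *\<^sub>R plane_similarity 0 0"
proof (induction k)
  case 0
  show ?case
    by (simp add: matrix_3_eq_iff mat_1_3_nth plane_similarity_def)
next
  case (Suc k)
  let ?J = "infinitesimal_rotation \<theta>"
  have "(1 / fact (Suc k)) *\<^sub>R ((**) ?J ^^ Suc k) (mat 1) =
      (1 / real (Suc k)) *\<^sub>R (?J ** ((1 / fact k) *\<^sub>R ((**) ?J ^^ k) (mat 1)))"
    by (simp add: matrix_scalar_ac field_simps flip: scalar_matrix_assoc)
  also have "\<dots> = (cos_coeff (Suc k) * \<theta> ^ Suc k) *\<^sub>R (plane_similarity 1 0 - plane_similarity 0 0)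
     + (sin_coeff (Suc k) * \<theta> ^ Suc k) *\<^sub>R (plane_similarity 0 1 - plane_similarity 0 0)"
    unfolding Suc.IH
    by (simp add: matrix_3_eq_iff matrix_mult_3_nth plane_similarity_def infinitesimal_rotation_def
        sin_coeff_Suc cos_coeff_Suc field_simps)
  finally show ?case by simp
qed

lemma infinitesimal_rotation_exp_sums:
  "(\<lambda>k. (1 / fact k) *\<^sub>R ((**) (infinitesimal_rotation \<theta>) ^^ k) (mat 1)) sums
     plane_similarity (cos \<theta>) (sin \<theta>)"
proof -
  have "(\<lambda>k. (cos_coeff k * \<theta> ^ k) *\<^sub>R (plane_similarity 1 0 - plane_similarity 0 0)
       + (sin_coeff k * \<theta> ^ k) *\<^sub>R (plane_similarity 0 1 - plane_similarity 0 0)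
       + (if k = 0 then 1 else 0) *\<^sub>R plane_similarity 0 0)
     sums (cos \<theta> *\<^sub>R (plane_similarity 1 0 - plane_similarity 0 0)
       + sin \<theta> *\<^sub>R (plane_similarity 0 1 - plane_similarity 0 0)
       + 1 *\<^sub>R plane_similarity 0 0)"
    using cos_converges[of \<theta>] sin_converges[of \<theta>] sums_single[of 0 "\<lambda>_. 1 :: real"]
    by (intro sums_add bounded_linear.sums[OF bounded_linear_scaleR_left])
      (simp_all add: eq_commute)
  also have "cos \<theta> *\<^sub>R (plane_similarity 1 0 - plane_similarity 0 0)
       + sin \<theta> *\<^sub>R (plane_similarity 0 1 - plane_similarity 0 0)
       + 1 *\<^sub>R plane_similarity 0 0 = plane_similarity (cos \<theta>) (sin \<theta>)"
    by (simp add: matrix_3_eq_iff plane_similarity_def)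
  finally show ?thesis
    by (simp only: infinitesimal_rotation_power)
qed

lemma power_conjugate:
  fixes X P J Q :: "real^'n^'n"
  assumes "X ** P = P ** J" and "P ** Q = mat 1"
  shows "((**) X ^^ k) (mat 1) = P ** ((**) J ^^ k) (mat 1) ** Q"
proof (induction k)
  case 0
  show ?case using assms(2) by simp
next
  case (Suc k)
  then show ?case using assms(1) by (simp add: matrix_mul_assoc)
qed

lemma bounded_linear_conjugation:
  fixes P Q :: "real^'n^'n"
  shows "bounded_linear (\<lambda>A. P ** A ** Q)"
proof -
  have add_mult: "(A + B) ** Q = A ** Q + B ** Q" for A B
    by (simp add: vec_eq_iff matrix_matrix_mult_def distrib_right sum.distrib)
  have "linear (\<lambda>A. P ** A ** Q)"
    by (rule linearI)
      (simp_all add: matrix_add_ldistrib matrix_scalar_ac add_mult flip: scalar_matrix_assoc)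
  then show ?thesis by (simp add: linear_linear)
qed

lemma matrix_exp_eq_conjugate_rotation:
  fixes X P Q :: "real^3^3"
  assumes "X ** P = P ** infinitesimal_rotation \<theta>" and "P ** Q = mat 1"
  shows "matrix_exp X = P ** plane_similarity (cos \<theta>) (sin \<theta>) ** Q"
proof -
  have "(\<lambda>k. P ** ((1 / fact k) *\<^sub>R ((**) (infinitesimal_rotation \<theta>) ^^ k) (mat 1)) ** Q)
      sums (P ** plane_similarity (cos \<theta>) (sin \<theta>) ** Q)"
    by (rule bounded_linear.sums
        [OF bounded_linear_conjugation[of P Q] infinitesimal_rotation_exp_sums[of \<theta>]])
  then have "(\<lambda>k. (1 / fact k) *\<^sub>R ((**) X ^^ k) (mat 1)) sums
      (P ** plane_similarity (cos \<theta>) (sin \<theta>) ** Q)"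
    unfolding power_conjugate[OF assms] by (simp add: matrix_scalar_ac flip: scalar_matrix_assoc)
  then show ?thesis
    unfolding matrix_exp_def by (rule sums_unique[symmetric])
qed

lemma one_parameter_subgroup_rotation:
  "one_parameter_subgroup SL (\<lambda>t. plane_similarity (cos (\<beta> * t)) (sin (\<beta> * t)))"
proof -
  have "continuous_on UNIV (\<lambda>t. cos (\<beta> * t) *\<^sub>R (plane_similarity 1 0 - plane_similarity 0 0)
      + sin (\<beta> * t) *\<^sub>R (plane_similarity 0 1 - plane_similarity 0 0) + plane_similarity 0 0)"
    by (intro continuous_intros)
  moreover have "cos (\<beta> * t) *\<^sub>R (plane_similarity 1 0 - plane_similarity 0 0)
      + sin (\<beta> * t) *\<^sub>R (plane_similarity 0 1 - plane_similarity 0 0) + plane_similarity 0 0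
      = plane_similarity (cos (\<beta> * t)) (sin (\<beta> * t))" for t
    by (simp add: matrix_3_eq_iff plane_similarity_def)
  ultimately have "continuous_on UNIV (\<lambda>t. plane_similarity (cos (\<beta> * t)) (sin (\<beta> * t)))"
    by simp
  moreover have "det (plane_similarity (cos \<theta>) (sin \<theta>)) = 1" for \<theta>
    by (simp add: plane_similarity_def det_3 flip: power2_eq_square)
  ultimately show ?thesis
    by (auto simp: one_parameter_subgroup_def SL_def hom_def plane_similarity_mult cos_add sin_add
        distrib_left algebra_simps)
qed

section \<open>The real normal form\<close>

lemma rotated_plane_of_imaginary_eigenvalue:
  fixes X :: "real^'n^'n"
  assumes "complex_eigenvalue X (\<i> * complex_of_real \<beta>)"
  obtains a b where "a \<noteq> 0 \<or> b \<noteq> 0" and "X *v a = - \<beta> *\<^sub>R b" and "X *v b = \<beta> *\<^sub>R a"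
proof -
  obtain v :: "complex^'n" where v: "v \<noteq> 0"
    and eig: "map_matrix complex_of_real X *v v = (\<i> * complex_of_real \<beta>) *s v"
    using assms by (auto simp: complex_eigenvalue_def)
  define a b where "a = (\<chi> i. Re (v $ i))" and "b = (\<chi> i. Im (v $ i))"
  have component: "(\<Sum>j\<in>UNIV. complex_of_real (X $ i $ j) * v $ j) = \<i> * complex_of_real \<beta> * v $ i" for i
    using eig by (simp add: vec_eq_iff matrix_vector_mult_def map_matrix_def)
  have "X *v a = - \<beta> *\<^sub>R b"
    using arg_cong[OF component, of Re]
    by (simp add: vec_eq_iff matrix_vector_mult_def a_def b_def Re_sum)
  moreover have "X *v b = \<beta> *\<^sub>R a"
    using arg_cong[OF component, of Im]
    by (simp add: vec_eq_iff matrix_vector_mult_def a_def b_def Im_sum)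
  moreover have "a \<noteq> 0 \<or> b \<noteq> 0"
    using v by (auto simp: vec_eq_iff a_def b_def complex_eq_iff)
  ultimately show ?thesis using that by blast
qed

text \<open>On a line through \<open>a\<close>, say \<open>b = c a\<close>, the two equations would force \<open>c\<^sup>2 = - 1\<close>.\<close>

lemma not_collinear_of_rotated:
  fixes X :: "real^'n^'n"
  assumes "\<beta> \<noteq> 0" and ab: "a \<noteq> 0 \<or> b \<noteq> 0" and Xa: "X *v a = - \<beta> *\<^sub>R b" and Xb: "X *v b = \<beta> *\<^sub>R a"
  shows "\<not> collinear {0, a, b}"
proof
  assume "collinear {0, a, b}"
  then consider "a = 0" | "b = 0" | c where "b = c *\<^sub>R a"
    by (auto simp: collinear_lemma)
  then show False
  proof cases
    case 1
    with Xa assms(1) ab show False by simp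
  next
    case 2
    with Xb assms(1) ab show False by simp
  next
    case 3
    have "\<beta> *\<^sub>R a = c *\<^sub>R (- \<beta> *\<^sub>R c *\<^sub>R a)"
      using Xb Xa by (simp add: 3 matrix_vector_mult_scaleR)
    then have "(\<beta> * (1 + c * c)) *\<^sub>R a = 0"
      by (simp add: algebra_simps)
    moreover have "1 + c * c \<noteq> 0"
      by (smt (verit) zero_le_square)
    ultimately have "a = 0"
      using assms(1) by simp
    with 3 ab show False by simp
  qed
qed

lemma matrix_mult_transpose_rows:
  fixes X :: "real^3^3"
  shows "X ** transpose (vector [a, b, c]) = transpose (vector [X *v a, X *v b, X *v c] :: real^3^3)"
  by (simp add: matrix_3_eq_iff matrix_mult_3_nth transpose_def matrix_vector_mult_def sum_3)

text \<open>The cross product \<open>w\<close> of \<open>a\<close> and \<open>b\<close> completes them to a basis of positive orientation. In this basis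
  \<open>X\<close> has a block triangular matrix whose last diagonal entry equals the trace of \<open>X\<close>, so \<open>X\<close> maps \<open>w\<close>
  into the plane of \<open>a\<close> and \<open>b\<close>. Since \<open>X\<close> is invertible on this plane, \<open>w\<close> can be corrected by a vector
  of the plane to lie in the kernel; this shear does not change the determinant.\<close>

lemma rotation_normal_form:
  fixes X :: "real^3^3"
  assumes "X \<in> sl" and \<beta>: "\<beta> \<noteq> 0" and "complex_eigenvalue X (\<i> * complex_of_real \<beta>)"
  obtains P where "det P > 0" and "X ** P = P ** infinitesimal_rotation \<beta>"
proof -
  obtain a b where ab: "a \<noteq> 0 \<or> b \<noteq> 0" and Xa: "X *v a = - \<beta> *\<^sub>R b" and Xb: "X *v b = \<beta> *\<^sub>R a"
    using assms(3) by (rule rotated_plane_of_imaginary_eigenvalue)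
  define w where "w = cross3 a b"
  have "w \<noteq> 0"
    using not_collinear_of_rotated[OF \<beta> ab Xa Xb] by (simp add: w_def cross_eq_0)
  define M where "M = transpose (vector [a, b, w] :: real^3^3)"
  have "det M = w \<bullet> w"
    by (simp add: M_def det_transpose flip: dot_cross_det) (simp add: w_def cross3_simps)
  then have M: "det M > 0"
    using \<open>w \<noteq> 0\<close> by simp
  define u where "u = matrix_inv M *v (X *v w)"
  have "M *v u = X *v w"
    using M by (simp add: u_def matrix_vector_mul_assoc matrix_mul_assoc matrix_inv_inverse)
  then have Xw: "X *v w = u$1 *\<^sub>R a + u$2 *\<^sub>R b + u$3 *\<^sub>R w"
    by (simp add: M_def vec_eq_iff forall_3 matrix_vector_mult_def sum_3 transpose_def mult.commute)
  have "u$3 = 0"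
  proof -
    \<comment> \<open>\<open>B\<close> is the matrix of \<open>X\<close> in the basis \<open>a, b, w\<close>.\<close>
    define B :: "real^3^3" where
      "B = transpose (vector [vector [0, - \<beta>, 0], vector [\<beta>, 0, 0], u])"
    have "X ** M = M ** B"
      unfolding M_def matrix_mult_transpose_rows Xa Xb Xw
      by (simp add: B_def matrix_3_eq_iff matrix_mult_3_nth transpose_def algebra_simps)
    then have "B = matrix_inv M ** (X ** M)"
      using M by (simp add: matrix_mul_assoc matrix_inv_inverse)
    then have "trace B = trace (X ** M ** matrix_inv M)"
      by (metis trace_mul_sym)
    also have "\<dots> = trace X"
      using M by (simp add: matrix_inv_inverse flip: matrix_mul_assoc)
    finally show ?thesis
      using assms(1) by (simp add: sl_def B_def trace_def sum_3 transpose_def)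
  qed
  define c where "c = w + (u$2 / \<beta>) *\<^sub>R a - (u$1 / \<beta>) *\<^sub>R b"
  have Xc: "X *v c = 0"
    using \<beta> by (simp add: c_def matrix_vector_right_distrib matrix_vector_mult_diff_distrib
        matrix_vector_mult_scaleR Xa Xb Xw \<open>u$3 = 0\<close>)
  define P where "P = transpose (vector [a, b, c] :: real^3^3)"
  have "det P = det M"
    by (simp add: P_def M_def c_def det_3 transpose_def algebra_simps)
  with M have "det P > 0" by simp
  moreover have "X ** P = P ** infinitesimal_rotation \<beta>"
    unfolding P_def matrix_mult_transpose_rows Xa Xb Xc
    by (simp add: infinitesimal_rotation_def matrix_3_eq_iff matrix_mult_3_nth transpose_def)
  ultimately show ?thesis by (rule that)
qed

theorem theorem14:
  fixes X :: "real^3^3" and \<beta> :: real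
  assumes "X \<in> sl"
    and "\<beta> \<noteq> 0"
    and "complex_eigenvalue X (\<i> * complex_of_real \<beta>)"
  shows "ambient_automorphic SL
           (\<lambda>t. matrix_exp (t *\<^sub>R X))
           (\<lambda>t. vector [vector [cos (\<beta> * t), sin (\<beta> * t), 0],
                         vector [- sin (\<beta> * t), cos (\<beta> * t), 0],
                         vector [0, 0, 1]])"
proof -
  obtain P where P: "det P > 0" and XP: "X ** P = P ** infinitesimal_rotation \<beta>"
    using assms by (rule rotation_normal_form)
  have "matrix_exp (t *\<^sub>R X) = P ** plane_similarity (cos (\<beta> * t)) (sin (\<beta> * t)) ** matrix_inv P" for t
  proof (rule matrix_exp_eq_conjugate_rotation)
    have "infinitesimal_rotation (\<beta> * t) = t *\<^sub>R infinitesimal_rotation \<beta>"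
      by (simp add: matrix_3_eq_iff infinitesimal_rotation_def)
    then show "(t *\<^sub>R X) ** P = P ** infinitesimal_rotation (\<beta> * t)"
      by (simp add: matrix_scalar_ac XP flip: scalar_matrix_assoc)
    show "P ** matrix_inv P = mat 1"
      using P by (simp add: matrix_inv_inverse)
  qed
  moreover have "ambient_automorphic SL
      (\<lambda>t. P ** plane_similarity (cos (\<beta> * t)) (sin (\<beta> * t)) ** matrix_inv P)
      (\<lambda>t. plane_similarity (cos (\<beta> * t)) (sin (\<beta> * t)))"
    using P by (intro ambient_automorphic_conjugate one_parameter_subgroup_rotation)
      (simp add: connected_to_1_iff)
  ultimately show ?thesis
    by (simp add: plane_similarity_def)
qed

end
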